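(* No amply regular graph with parameters $(n,d,\alpha,1)$ is Lichnerowicz sharp.
   Context: All graphs are finite and simple. A non-complete connected $d$-regular graph on $n$ vertices is amply regular with parameters $(n,d,\alpha,\beta)$ if any two adjacent vertices have exactly $\alpha$ common neighbours and any two vertices at distance $2$ have exactly $\beta$ common neighbours. Lin–Lu–Yau curvature: for a vertex $x$ and $p\in[0,1]$ let $\mu_x^p(x)=p$, $\mu_x^p(y)=(1-p)/\deg(x)$ for neighbours $y$ of $x$, and $0$ otherwise; $W_1$ is the $L^1$-Wasserstein (optimal transport) distance with respect to the graph distance $d$; $\kappa_p(x,y)=1-W_1(\mu_x^p,\mu_y^p)/d(x,y)$ and $\kappa(x,y)=\lim_{p\to1}\kappa_p(x,y)/(1-p)$. The normalized Laplacian is $L=I-D^{-1/2}AD^{-1/2}$ and $\lambda_1$ is its smallest nonzero eigenvalue. A connected graph $G=(V,E)$ is Lichnerowicz sharp if $\lambda_1=\min_{xy\in E}\kappa(x,y)$. *)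

theory Defs
  imports
    Complex_Main
    "Graph_Theory.Digraph_Component"
    "Graph_Theory.Shortest_Path"
    "Graph_Theory.Kuratowski"
begin

text \<open>
  A finite simple graph is a \<open>pair_graph\<close>: a finite vertex set with a symmetric irreflexive set
  of arcs. An edge \<open>xy\<close> is the pair of arcs \<open>(x, y)\<close>, \<open>(y, x)\<close>, so the degree of a vertex is its
  \<open>out_degree\<close>.
\<close>

definition graph_dist :: "'v pair_pre_digraph \<Rightarrow> 'v \<Rightarrow> 'v \<Rightarrow> real" where
  "graph_dist G x y = real_of_ereal (wf_digraph.\<mu> (with_proj G) (\<lambda>_. 1) x y)"

definition common_neighbours :: "'v pair_pre_digraph \<Rightarrow> 'v \<Rightarrow> 'v \<Rightarrow> 'v set" where
  "common_neighbours G x y = {z. (x, z) \<in> parcs G \<and> (y, z) \<in> parcs G}"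

definition amply_regular :: "'v pair_pre_digraph \<Rightarrow> nat \<Rightarrow> nat \<Rightarrow> nat \<Rightarrow> nat \<Rightarrow> bool" where
  "amply_regular G n d \<alpha> \<beta> \<longleftrightarrow>
     pair_graph G \<and> Digraph_Component.connected (with_proj G) \<and>
     card (pverts G) = n \<and> \<not> complete_digraph n (with_proj G) \<and>
     (\<forall>x \<in> pverts G. out_degree (with_proj G) x = d) \<and>
     (\<forall>x \<in> pverts G. \<forall>y \<in> pverts G. (x, y) \<in> parcs G \<longrightarrow> card (common_neighbours G x y) = \<alpha>) \<and>
     (\<forall>x \<in> pverts G. \<forall>y \<in> pverts G. graph_dist G x y = 2 \<longrightarrow> card (common_neighbours G x y) = \<beta>)"

definition lazy_measure :: "'v pair_pre_digraph \<Rightarrow> real \<Rightarrow> 'v \<Rightarrow> 'v \<Rightarrow> real" where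
  "lazy_measure G p x y =
     (if y = x then p
      else if (x, y) \<in> parcs G then (1 - p) / real (out_degree (with_proj G) x)
      else 0)"

definition couplings ::
  "'v pair_pre_digraph \<Rightarrow> ('v \<Rightarrow> real) \<Rightarrow> ('v \<Rightarrow> real) \<Rightarrow> ('v \<Rightarrow> 'v \<Rightarrow> real) set" where
  "couplings G \<mu> \<nu> =
     {\<pi>. (\<forall>u \<in> pverts G. \<forall>v \<in> pverts G. 0 \<le> \<pi> u v) \<and>
         (\<forall>u \<in> pverts G. (\<Sum>v \<in> pverts G. \<pi> u v) = \<mu> u) \<and>
         (\<forall>v \<in> pverts G. (\<Sum>u \<in> pverts G. \<pi> u v) = \<nu> v)}"

definition wasserstein :: "'v pair_pre_digraph \<Rightarrow> ('v \<Rightarrow> real) \<Rightarrow> ('v \<Rightarrow> real) \<Rightarrow> real" where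
  "wasserstein G \<mu> \<nu> =
     (INF \<pi> \<in> couplings G \<mu> \<nu>. \<Sum>u \<in> pverts G. \<Sum>v \<in> pverts G. graph_dist G u v * \<pi> u v)"

definition lazy_curvature :: "'v pair_pre_digraph \<Rightarrow> real \<Rightarrow> 'v \<Rightarrow> 'v \<Rightarrow> real" where
  "lazy_curvature G p x y =
     1 - wasserstein G (lazy_measure G p x) (lazy_measure G p y) / graph_dist G x y"

text \<open>The limit is one-sided since the idleness \<open>p\<close> ranges over \<open>[0, 1]\<close>.\<close>

definition lly_curvature :: "'v pair_pre_digraph \<Rightarrow> 'v \<Rightarrow> 'v \<Rightarrow> real" where
  "lly_curvature G x y = Lim (at_left 1) (\<lambda>p. lazy_curvature G p x y / (1 - p))"

text \<open>Entries of \<open>I - D\<^sup>-\<^sup>1\<^sup>/\<^sup>2 A D\<^sup>-\<^sup>1\<^sup>/\<^sup>2\<close>, indexed by vertices.\<close>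

definition normalized_laplacian :: "'v pair_pre_digraph \<Rightarrow> 'v \<Rightarrow> 'v \<Rightarrow> real" where
  "normalized_laplacian G x y =
     of_bool (x = y) -
     real (out_degree (with_proj G) x) powr (- 1 / 2) * of_bool ((x, y) \<in> parcs G) *
     real (out_degree (with_proj G) y) powr (- 1 / 2)"

definition laplacian_eigenvalue :: "'v pair_pre_digraph \<Rightarrow> real \<Rightarrow> bool" where
  "laplacian_eigenvalue G c \<longleftrightarrow>
     (\<exists>f :: 'v \<Rightarrow> real. (\<exists>x \<in> pverts G. f x \<noteq> 0) \<and>
        (\<forall>x \<in> pverts G. (\<Sum>y \<in> pverts G. normalized_laplacian G x y * f y) = c * f x))"

definition lambda1 :: "'v pair_pre_digraph \<Rightarrow> real" where
  "lambda1 G = Min {c. laplacian_eigenvalue G c \<and> c \<noteq> 0}"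

definition lichnerowicz_sharp :: "'v pair_pre_digraph \<Rightarrow> bool" where
  "lichnerowicz_sharp G \<longleftrightarrow>
     pair_graph G \<and> Digraph_Component.connected (with_proj G) \<and>
     lambda1 G = Min ((\<lambda>(x, y). lly_curvature G x y) ` parcs G)"

end

theory Submission
  imports Defs "HOL-Analysis.Function_Topology"
begin

text \<open>
  Suppose the graph is Lichnerowicz sharp. Then every edge has positive curvature. For an edge \<open>xy\<close>,
  no private neighbour of \<open>x\<close> (one outside \<open>y\<close> and its neighbourhood) is adjacent to a private neighbour of \<open>y\<close>, since \<open>\<beta> = 1\<close> forbids induced
  quadrangles. Taking the distance to the private neighbours of \<open>y\<close> as Kantorovich potential, positivity
  forces \<open>d = 2\<alpha> + 2\<close>, curvature at most \<open>1/d\<close>, and a perfect matching between the two sets of private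
  neighbours along pairs at distance 2; so every edge lies on induced pentagons.

  Let \<open>f\<close> be an eigenfunction for \<open>\<lambda>\<^sub>1 \<le> 1/d\<close> and \<open>xy\<close> an edge on which \<open>f\<close> drops by the maximal amount
  \<open>M > 0\<close>. Comparing the eigenvalue equations at \<open>x\<close> and \<open>y\<close> forces \<open>f\<close> to drop by \<open>2M\<close> along every
  matched pair, hence by \<open>M\<close> along further edges of a pentagon. Applying this to three edges of
  one pentagon gives drops that do not add up around it.
\<close>

section \<open>Eigenvalues of symmetric matrices\<close>

text \<open>\<open>lambda1\<close> is a \<open>Min\<close>, which is informative only for a finite
  set. Unit eigenvectors for distinct eigenvalues are orthonormal, so summing Bessel's inequality
  over \<open>V\<close> leaves room for at most \<open>card V\<close> of them.\<close>

lemma symmetric_matrix_eigenvalues_finite: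
  fixes L :: "'v \<Rightarrow> 'v \<Rightarrow> real"
  assumes V: "finite V" and sym: "\<And>x y. x \<in> V \<Longrightarrow> y \<in> V \<Longrightarrow> L x y = L y x"
  shows "finite {c. \<exists>f. (\<exists>x\<in>V. f x \<noteq> 0) \<and> (\<forall>x\<in>V. (\<Sum>y\<in>V. L x y * f y) = c * f x)}"
    (is "finite ?E")
proof -
  have "card S \<le> card V" if S: "S \<subseteq> ?E" "finite S" for S
  proof -
    have "\<exists>f. (\<Sum>x\<in>V. (f x)\<^sup>2) = 1 \<and> (\<forall>x\<in>V. (\<Sum>y\<in>V. L x y * f y) = c * f x)" if c: "c \<in> S" for c
    proof -
      obtain f where f: "\<exists>x\<in>V. f x \<noteq> 0" "\<forall>x\<in>V. (\<Sum>y\<in>V. L x y * f y) = c * f x"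
        using S(1) c by blast
      define s where "s = (\<Sum>x\<in>V. (f x)\<^sup>2)"
      have "s > 0"
        unfolding s_def using f(1) V by (auto intro!: sum_pos2)
      have "(\<Sum>x\<in>V. (f x / sqrt s)\<^sup>2) = 1"
        using \<open>s > 0\<close> by (simp add: power_divide sum_divide_distrib[symmetric] s_def[symmetric])
      moreover have "(\<Sum>y\<in>V. L x y * (f y / sqrt s)) = c * (f x / sqrt s)" if "x \<in> V" for x
        using f(2) that by (simp add: sum_divide_distrib[symmetric])
      ultimately show ?thesis by (intro exI[of _ "\<lambda>x. f x / sqrt s"]) auto
    qed
    then obtain F where F: "\<And>c. c \<in> S \<Longrightarrow> (\<Sum>x\<in>V. (F c x)\<^sup>2) = 1"
      "\<And>c x. c \<in> S \<Longrightarrow> x \<in> V \<Longrightarrow> (\<Sum>y\<in>V. L x y * F c y) = c * F c x"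
      by metis
    have orth: "(\<Sum>x\<in>V. F c x * F c' x) = (if c = c' then 1 else 0)" if "c \<in> S" "c' \<in> S" for c c'
    proof (cases "c = c'")
      case True
      then show ?thesis using F(1)[OF that(1)] by (simp add: power2_eq_square)
    next
      case False
      have "c * (\<Sum>x\<in>V. F c x * F c' x) = (\<Sum>x\<in>V. (\<Sum>y\<in>V. L x y * F c y) * F c' x)"
        using F(2)[OF that(1)] by (simp add: sum_distrib_left mult.assoc)
      also have "\<dots> = (\<Sum>x\<in>V. \<Sum>y\<in>V. L x y * F c y * F c' x)"
        by (simp add: sum_distrib_right)
      also have "\<dots> = (\<Sum>y\<in>V. \<Sum>x\<in>V. L x y * F c y * F c' x)"
        by (rule sum.swap)
      also have "\<dots> = (\<Sum>y\<in>V. F c y * (\<Sum>x\<in>V. L y x * F c' x))"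
        by (auto simp: sum_distrib_left sym intro!: sum.cong)
      also have "\<dots> = c' * (\<Sum>x\<in>V. F c x * F c' x)"
        using F(2)[OF that(2)] by (simp add: sum_distrib_left mult_ac)
      finally show ?thesis using False by simp
    qed
    \<comment> \<open>Bessel's inequality for the indicator function of \<open>x\<close>\<close>
    have bessel: "(\<Sum>c\<in>S. (F c x)\<^sup>2) \<le> 1" if x: "x \<in> V" for x
    proof -
      \<comment> \<open>\<open>P\<close> is the orthogonal projection of the indicator of
        \<open>x\<close> to the span of the \<open>F c\<close>, hence its squared norm equals
        \<open>P x\<close>.\<close>
      define P where "P y = (\<Sum>c\<in>S. F c x * F c y)" for y
      have Px: "P x = (\<Sum>c\<in>S. (F c x)\<^sup>2)" by (simp add: P_def power2_eq_square)
      have "(\<Sum>y\<in>V. (P y)\<^sup>2) = (\<Sum>y\<in>V. \<Sum>c\<in>S. \<Sum>c'\<in>S. F c x * F c' x * (F c y * F c' y))"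
        by (simp add: P_def power2_eq_square sum_product mult_ac)
      also have "\<dots> = (\<Sum>c\<in>S. \<Sum>c'\<in>S. \<Sum>y\<in>V. F c x * F c' x * (F c y * F c' y))"
        by (subst sum.swap, rule sum.cong[OF refl], rule sum.swap)
      also have "\<dots> = (\<Sum>c\<in>S. \<Sum>c'\<in>S. F c x * F c' x * (if c = c' then 1 else 0))"
        by (auto simp: sum_distrib_left[symmetric] orth intro!: sum.cong)
      also have "\<dots> = P x"
        using S(2) by (simp add: Px power2_eq_square if_distrib cong: if_cong)
      finally have PP: "(\<Sum>y\<in>V. (P y)\<^sup>2) = P x" .
      have "0 \<le> (\<Sum>y\<in>V. (of_bool (y = x) - P y)\<^sup>2)" by (intro sum_nonneg) auto
      also have "\<dots> = (\<Sum>y\<in>V. (if y = x then 1 - 2 * P y else 0) + (P y)\<^sup>2)"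
        by (intro sum.cong) (auto simp: power2_eq_square algebra_simps)
      also have "\<dots> = 1 - 2 * P x + P x"
        using V x by (simp add: sum.distrib PP)
      finally show ?thesis using Px by simp
    qed
    have "real (card S) = (\<Sum>c\<in>S. \<Sum>x\<in>V. (F c x)\<^sup>2)" using F(1) by simp
    also have "\<dots> = (\<Sum>x\<in>V. \<Sum>c\<in>S. (F c x)\<^sup>2)" by (rule sum.swap)
    also have "\<dots> \<le> (\<Sum>x\<in>V. 1)" using bessel by (intro sum_mono) auto
    finally show ?thesis by simp
  qed
  then show ?thesis
    using finite_if_finite_subsets_card_bdd by blast
qed

text \<open>A maximiser of the Rayleigh quotient is an eigenvector, and the maximum dominates every
  diagonal entry.\<close>

lemma symmetric_matrix_eigenvalue_ge_diagonal:
  fixes L :: "'v \<Rightarrow> 'v \<Rightarrow> real"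
  assumes V: "finite V" and sym: "\<And>x y. x \<in> V \<Longrightarrow> y \<in> V \<Longrightarrow> L x y = L y x" and z: "z \<in> V"
  obtains c f where "\<exists>x\<in>V. f x \<noteq> 0" "\<forall>x\<in>V. (\<Sum>y\<in>V. L x y * f y) = c * f x" "L z z \<le> c"
proof -
  define q where "q f = (\<Sum>x\<in>V. \<Sum>y\<in>V. L x y * (f x * f y))" for f :: "'v \<Rightarrow> real"
  define s where "s f = (\<Sum>x\<in>V. (f x)\<^sup>2)" for f :: "'v \<Rightarrow> real"
  \<comment> \<open>The type \<open>'v\<close> may be infinite. Pinning all coordinates outside
    \<open>V\<close> to 0 gives a box that is compact by Tychonoff and contains the unit sphere over
    \<open>V\<close>.\<close>
  define K where "K = PiE UNIV (\<lambda>x. if x \<in> V then {-1..1::real} else {0})"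
  have "compactin (product_topology (\<lambda>_. euclidean) UNIV) K"
    unfolding K_def by (subst compactin_PiE) auto
  then have "compact K"
    by (simp add: euclidean_product_topology)
  moreover have cont: "continuous_on UNIV q" "continuous_on UNIV s"
    unfolding q_def[abs_def] s_def[abs_def] by (intro continuous_intros; simp)+
  then have "closed {f. s f = 1}"
    by (intro closed_Collect_eq) auto
  ultimately have "compact (K \<inter> {f. s f = 1})"
    by (rule compact_Int_closed)
  have delta_sum: "(\<Sum>y\<in>V. g y * of_bool (y = w)) = g w" if "w \<in> V" for g :: "'v \<Rightarrow> real" and w
    using V that by (simp add: of_bool_def if_distrib cong: if_cong)
  have delta_s: "s (\<lambda>y. of_bool (y = z)) = 1"
    using delta_sum[OF z, of "\<lambda>y. of_bool (y = z)"] by (simp add: s_def power2_eq_square)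
  have "(\<lambda>y. of_bool (y = z)) \<in> K \<inter> {f. s f = 1}"
    using delta_s z by (auto simp: K_def)
  then have "K \<inter> {f. s f = 1} \<noteq> {}" by blast
  then obtain f where f: "f \<in> K" "s f = 1" and f_max: "\<And>g. g \<in> K \<Longrightarrow> s g = 1 \<Longrightarrow> q g \<le> q f"
    using continuous_attains_sup[OF \<open>compact (K \<inter> _)\<close> _ continuous_on_subset[OF cont(1)]] by blast
  \<comment> \<open>By homogeneity the bound extends from unit vectors in \<open>K\<close> to all
    functions.\<close>
  have max: "q g \<le> q f * s g" for g
  proof (cases "s g = 0")
    case True
    then have "g x = 0" if "x \<in> V" for x
      using V that by (simp add: s_def sum_nonneg_eq_0_iff)
    then have "q g = 0" by (simp add: q_def)
    then show ?thesis using True by simp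
  next
    case False
    moreover have "s g \<ge> 0" by (simp add: s_def sum_nonneg)
    ultimately have pos: "s g > 0" by simp
    define h where "h x = (if x \<in> V then g x / sqrt (s g) else 0)" for x
    have sh: "s h = 1"
      using pos by (simp add: h_def s_def power_divide sum_divide_distrib[symmetric] sum_nonneg
          real_sqrt_pow2)
    have "q h = (\<Sum>x\<in>V. \<Sum>y\<in>V. L x y * (g x * g y) / s g)"
      unfolding q_def using pos by (auto simp: h_def intro!: sum.cong)
    then have qh: "q h = q g / s g"
      by (simp add: q_def sum_divide_distrib)
    have "h \<in> K"
    proof -
      have bound: "\<bar>h x\<bar> \<le> 1" if "x \<in> V" for x
      proof -
        have "(h x)\<^sup>2 \<le> s h"
          unfolding s_def using V that by (intro member_le_sum) auto
        then show ?thesis using sh by (simp add: abs_square_le_1)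
      qed
      have "h x \<in> (if x \<in> V then {-1..1} else {0})" for x
      proof (cases "x \<in> V")
        case True
        then show ?thesis using bound[of x] by auto
      qed (simp add: h_def)
      then show ?thesis unfolding K_def by blast
    qed
    then show ?thesis using f_max[OF _ sh] qh pos by (simp add: field_simps)
  qed
  show thesis
  proof
    show "\<exists>x\<in>V. f x \<noteq> 0"
    proof (rule ccontr)
      assume "\<not> (\<exists>x\<in>V. f x \<noteq> 0)"
      then have "s f = 0" by (simp add: s_def)
      then show False using f(2) by simp
    qed
    have "q (\<lambda>y. of_bool (y = z)) = (\<Sum>x\<in>V. (\<Sum>y\<in>V. L x y * of_bool (y = z)) * of_bool (x = z))"
      by (simp add: q_def sum_distrib_left sum_distrib_right mult_ac)
    also have "\<dots> = L z z"
      using z by (simp add: delta_sum)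
    finally show "L z z \<le> q f"
      using max[of "\<lambda>y. of_bool (y = z)"] delta_s by simp
    show "\<forall>x\<in>V. (\<Sum>y\<in>V. L x y * f y) = q f * f x"
    proof
      fix x assume x: "x \<in> V"
      define r where "r = (\<Sum>y\<in>V. L x y * f y) - q f * f x"
      \<comment> \<open>First variation: moving \<open>f\<close> by \<open>t\<close> in the
        coordinate \<open>x\<close> cannot raise the Rayleigh quotient.\<close>
      have key: "2 * t * r \<le> t\<^sup>2 * (q f - L x x)" for t
      proof -
        let ?g = "\<lambda>y. f y + t * of_bool (y = x)"
        have "s ?g = (\<Sum>y\<in>V. (f y)\<^sup>2 + (2 * t * f y + t\<^sup>2) * of_bool (y = x))"
          unfolding s_def by (intro sum.cong) (auto simp: power2_eq_square algebra_simps)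
        then have sg: "s ?g = 1 + 2 * t * f x + t\<^sup>2"
          using f(2) x by (simp add: sum.distrib delta_sum s_def)
        have row: "(\<Sum>y\<in>V. L w y * (f y + t * of_bool (y = x))) = (\<Sum>y\<in>V. L w y * f y) + t * L w x"
          if "w \<in> V" for w
        proof -
          have "(\<Sum>y\<in>V. L w y * (f y + t * of_bool (y = x)))
              = (\<Sum>y\<in>V. L w y * f y + t * L w y * of_bool (y = x))"
            by (intro sum.cong) (auto simp: algebra_simps)
          then show ?thesis
            using x by (simp add: sum.distrib delta_sum)
        qed
        have "q ?g = (\<Sum>w\<in>V. (\<Sum>y\<in>V. L w y * (f y + t * of_bool (y = x))) * (f w + t * of_bool (w = x)))"
          by (simp add: q_def sum_distrib_left sum_distrib_right mult_ac)
        also have "\<dots> = (\<Sum>w\<in>V. ((\<Sum>y\<in>V. L w y * f y) + t * L w x) * (f w + t * of_bool (w = x)))"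
          using row by simp
        also have "\<dots> = (\<Sum>w\<in>V. (\<Sum>y\<in>V. L w y * f y) * f w) + t * (\<Sum>w\<in>V. L w x * f w)
            + (\<Sum>w\<in>V. (((\<Sum>y\<in>V. L w y * f y) + t * L w x) * t) * of_bool (w = x))"
          by (simp add: sum.distrib[symmetric] sum_distrib_left algebra_simps)
        also have "(\<Sum>w\<in>V. (((\<Sum>y\<in>V. L w y * f y) + t * L w x) * t) * of_bool (w = x))
            = ((\<Sum>y\<in>V. L x y * f y) + t * L x x) * t"
          using x by (rule delta_sum)
        also have "(\<Sum>w\<in>V. L w x * f w) = (\<Sum>w\<in>V. L x w * f w)"
          using x by (intro sum.cong) (auto simp: sym)
        also have "(\<Sum>w\<in>V. (\<Sum>y\<in>V. L w y * f y) * f w) = q f"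
          by (simp add: q_def sum_distrib_left sum_distrib_right mult_ac)
        finally have "q ?g = q f + 2 * t * (\<Sum>y\<in>V. L x y * f y) + t\<^sup>2 * L x x"
          by (simp add: power2_eq_square algebra_simps)
        with max[of ?g] sg show ?thesis
          by (simp add: r_def algebra_simps)
      qed
      have "r = 0"
      proof (rule ccontr)
        assume "r \<noteq> 0"
        \<comment> \<open>For \<open>t = r / D\<close> the linear term \<open>2 * t * r\<close>
          outweighs the quadratic one; adding 1 keeps \<open>D\<close> positive.\<close>
        define D where "D = \<bar>q f - L x x\<bar> + 1"
        have D: "D > 0" "q f - L x x < D" by (auto simp: D_def)
        have "2 * (r / D) * r \<le> (r / D)\<^sup>2 * (q f - L x x)" by (rule key)
        also have "\<dots> \<le> (r / D)\<^sup>2 * D"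
          using D by (intro mult_left_mono) auto
        also have "\<dots> = (r / D) * r"
          using D by (simp add: power2_eq_square)
        finally have "r\<^sup>2 / D \<le> 0" by (simp add: power2_eq_square)
        with D \<open>r \<noteq> 0\<close> show False by (simp add: divide_le_0_iff)
      qed
      then show "(\<Sum>y\<in>V. L x y * f y) = q f * f x" by (simp add: r_def)
    qed
  qed
qed

section \<open>Curvature of regular graphs\<close>

locale connected_regular_graph = pair_graph G for G :: "'v pair_pre_digraph" +
  fixes d :: nat
  assumes connected: "Digraph_Component.connected (with_proj G)"
    and regular: "x \<in> pverts G \<Longrightarrow> out_degree (with_proj G) x = d"
begin

section \<open>Neighbourhoods and the graph distance\<close>

abbreviation N :: "'v \<Rightarrow> 'v set" where
  "N x \<equiv> {y. (x, y) \<in> parcs G}"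

lemma arc_sym: "(x, y) \<in> parcs G \<Longrightarrow> (y, x) \<in> parcs G"
  using arcs_ends_symmetric[OF pair_sym_arcs] graph_symmetric by auto

lemma N_subset: "N x \<subseteq> pverts G"
  using in_arcsD2 by auto

lemma finite_N [simp]: "finite (N x)"
  using N_subset pair_finite_verts by (rule finite_subset)

lemma card_N: "x \<in> pverts G \<Longrightarrow> card (N x) = d"
proof -
  assume x: "x \<in> pverts G"
  have "out_arcs (with_proj G) x = Pair x ` N x"
    by (auto simp: out_arcs_def)
  then show ?thesis
    using regular[OF x] by (simp add: out_degree_def card_image inj_on_def)
qed

lemma degree_pos: "(x, y) \<in> parcs G \<Longrightarrow> 0 < d"
  using card_N[of x] in_arcsD1[of x y] card_gt_0_iff[of "N x"] by auto

lemma ex_awalk: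
  assumes "u \<in> pverts G" "v \<in> pverts G"
  shows "\<exists>p. awalk u p v"
  using symmetric_connected_imp_strongly_connected[OF pair_sym_arcs connected] assms
  by (auto simp: strongly_connected_def reachable_awalk)

text \<open>With unit weights the infimum over walks is attained by a walk of least length, so
  \<open>graph_dist\<close> is a genuine length and never the default value of
  \<open>real_of_ereal\<close> at infinity.\<close>

lemma graph_dist_awalk:
  assumes "u \<in> pverts G" "v \<in> pverts G"
  obtains p where "awalk u p v" "graph_dist G u v = real (length p)"
    "\<And>q. awalk u q v \<Longrightarrow> length p \<le> length q"
proof -
  obtain p where p: "awalk u p v" "\<And>q. awalk u q v \<Longrightarrow> length p \<le> length q"
    using ex_has_least_nat[of "\<lambda>p. awalk u p v" _ length] ex_awalk[OF assms] by metis
  have cost: "awalk_cost (\<lambda>_. 1) q = real (length q)" for q :: "('v \<times> 'v) list"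
    by (induction q) auto
  have "\<mu> (\<lambda>_. 1) u v = ereal (real (length p))"
    unfolding \<mu>_def cost
    by (rule antisym) (use p in \<open>auto intro!: INF_lower2 INF_greatest\<close>)
  then show thesis
    using that p by (simp add: graph_dist_def)
qed

lemma graph_dist_nonneg: "u \<in> pverts G \<Longrightarrow> v \<in> pverts G \<Longrightarrow> 0 \<le> graph_dist G u v"
  by (metis graph_dist_awalk of_nat_0_le_iff)

lemma graph_dist_adjacent:
  assumes "(u, v) \<in> parcs G"
  shows "graph_dist G u v = 1"
proof -
  have uv: "u \<in> pverts G" "v \<in> pverts G" "u \<noteq> v"
    using assms in_arcsD1 in_arcsD2 no_loops' by auto
  obtain p where p: "awalk u p v" "graph_dist G u v = real (length p)"
    "\<And>q. awalk u q v \<Longrightarrow> length p \<le> length q"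
    using graph_dist_awalk uv by metis
  have "awalk u [(u, v)] v"
    using assms uv by (simp add: awalk_simps)
  from p(3)[OF this] have "length p \<le> 1" by simp
  moreover have "p \<noteq> []" using p(1) uv by (auto simp: awalk_simps)
  ultimately show ?thesis using p(2) by (cases p) auto
qed

lemma graph_dist_eq_2:
  assumes "(u, w) \<in> parcs G" "(w, v) \<in> parcs G" "u \<noteq> v" "(u, v) \<notin> parcs G"
  shows "graph_dist G u v = 2"
proof -
  have uv: "u \<in> pverts G" "v \<in> pverts G"
    using assms in_arcsD1 in_arcsD2 by auto
  obtain p where p: "awalk u p v" "graph_dist G u v = real (length p)"
    "\<And>q. awalk u q v \<Longrightarrow> length p \<le> length q"
    using graph_dist_awalk uv by metis
  have "awalk u [(u, w), (w, v)] v"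
    using assms uv by (simp add: awalk_simps)
  from p(3)[OF this] have "length p \<le> 2" by simp
  moreover have "p \<noteq> []" using p(1) assms by (auto simp: awalk_simps)
  moreover have "p \<noteq> [e]" for e using p(1) assms by (cases e) (auto simp: awalk_simps)
  ultimately have "length p = 2"
    by (cases p; cases "tl p") auto
  then show ?thesis using p(2) by simp
qed

section \<open>Kantorovich duality and the curvature limit\<close>

definition lipschitz1 :: "('v \<Rightarrow> real) \<Rightarrow> bool" where
  "lipschitz1 f \<longleftrightarrow> (\<forall>u v. (u, v) \<in> parcs G \<longrightarrow> f u - f v \<le> 1)"

lemma lipschitz1_graph_dist:
  assumes f: "lipschitz1 f" and uv: "u \<in> pverts G" "v \<in> pverts G"
  shows "f u - f v \<le> graph_dist G u v"
proof -
  have "f u - f v \<le> length p" if "awalk u p v" for p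
    using that
  proof (induction p arbitrary: u)
    case (Cons e p)
    then have "(u, snd e) \<in> parcs G" "awalk (snd e) p v"
      by (auto simp: awalk_simps)
    with Cons.IH[of "snd e"] f show ?case
      unfolding lipschitz1_def by fastforce
  qed (auto simp: awalk_simps)
  then show ?thesis using graph_dist_awalk[OF uv] by metis
qed

lemma sum_lazy_measure:
  assumes "x \<in> pverts G"
  shows "(\<Sum>u\<in>pverts G. f u * lazy_measure G p x u) = p * f x + (1 - p) / d * (\<Sum>u\<in>N x. f u)"
proof -
  have V: "pverts G = insert x (N x \<union> (pverts G - insert x (N x)))" (is "_ = insert x (_ \<union> ?R)")
    using assms N_subset by auto
  have x: "x \<notin> N x" using no_loops' by auto
  have "(\<Sum>u\<in>pverts G. f u * lazy_measure G p x u)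
      = f x * p + ((\<Sum>u\<in>N x. f u * lazy_measure G p x u) + (\<Sum>u\<in>?R. f u * lazy_measure G p x u))"
    using pair_finite_verts x
    by (subst V, subst sum.insert, simp, simp, subst sum.union_disjoint) (auto simp: lazy_measure_def)
  also have "(\<Sum>u\<in>?R. f u * lazy_measure G p x u) = 0"
    by (intro sum.neutral) (auto simp: lazy_measure_def)
  also have "(\<Sum>u\<in>N x. f u * lazy_measure G p x u) = (\<Sum>u\<in>N x. (1 - p) / d * f u)"
    using x regular[OF assms] by (intro sum.cong) (auto simp: lazy_measure_def)
  finally show ?thesis by (simp add: sum_distrib_left)
qed

text \<open>Supplies the nonemptiness that \<open>wasserstein_ge\<close> needs, since a real infimum
  over the empty set carries no information.\<close>

lemma product_coupling:
  assumes xy: "x \<in> pverts G" "y \<in> pverts G" and p: "0 \<le> p" "p \<le> 1" and d: "0 < d"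
  shows "(\<lambda>u v. lazy_measure G p x u * lazy_measure G p y v)
    \<in> couplings G (lazy_measure G p x) (lazy_measure G p y)"
proof -
  have "(\<Sum>u\<in>pverts G. lazy_measure G p x u) = 1" if "x \<in> pverts G" for x
    using sum_lazy_measure[OF that, of "\<lambda>_. 1"] card_N[OF that] d by simp
  then show ?thesis
    using xy p by (auto simp: couplings_def sum_distrib_left[symmetric] sum_distrib_right[symmetric]
        intro!: mult_nonneg_nonneg) (auto simp: lazy_measure_def)
qed

definition transport_cost :: "('v \<Rightarrow> 'v \<Rightarrow> real) \<Rightarrow> real" where
  "transport_cost \<pi> = (\<Sum>u\<in>pverts G. \<Sum>v\<in>pverts G. graph_dist G u v * \<pi> u v)"

text \<open>The easy half of Kantorovich duality: \<open>graph_dist\<close> dominates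
  \<open>f u - f v\<close> pair by pair, and the marginals of \<open>\<pi>\<close> turn the double
  sum into two single ones.\<close>

lemma transport_cost_ge:
  assumes f: "lipschitz1 f" and \<pi>: "\<pi> \<in> couplings G m m'"
  shows "(\<Sum>u\<in>pverts G. f u * m u) - (\<Sum>u\<in>pverts G. f u * m' u) \<le> transport_cost \<pi>"
proof -
  have "(\<Sum>u\<in>pverts G. f u * m u) = (\<Sum>u\<in>pverts G. \<Sum>v\<in>pverts G. f u * \<pi> u v)"
    using \<pi> by (auto simp: couplings_def sum_distrib_left[symmetric])
  moreover have "(\<Sum>v\<in>pverts G. f v * m' v) = (\<Sum>u\<in>pverts G. \<Sum>v\<in>pverts G. f v * \<pi> u v)"
    using \<pi> by (subst sum.swap) (auto simp: couplings_def sum_distrib_left[symmetric])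
  ultimately have "(\<Sum>u\<in>pverts G. f u * m u) - (\<Sum>u\<in>pverts G. f u * m' u)
      = (\<Sum>u\<in>pverts G. \<Sum>v\<in>pverts G. (f u - f v) * \<pi> u v)"
    by (simp add: sum_subtractf left_diff_distrib)
  also have "\<dots> \<le> transport_cost \<pi>"
    unfolding transport_cost_def using \<pi> lipschitz1_graph_dist[OF f]
    by (intro sum_mono mult_right_mono) (auto simp: couplings_def)
  finally show ?thesis .
qed

lemma transport_cost_nonneg: "\<pi> \<in> couplings G m m' \<Longrightarrow> 0 \<le> transport_cost \<pi>"
  unfolding transport_cost_def
  by (intro sum_nonneg mult_nonneg_nonneg graph_dist_nonneg) (auto simp: couplings_def)

lemma wasserstein_le: "\<pi> \<in> couplings G m m' \<Longrightarrow> wasserstein G m m' \<le> transport_cost \<pi>"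
  unfolding wasserstein_def transport_cost_def[symmetric]
  by (intro cINF_lower bdd_belowI2[of _ 0]) (auto simp: transport_cost_nonneg)

lemma wasserstein_ge:
  assumes "couplings G m m' \<noteq> {}" "\<And>\<pi>. \<pi> \<in> couplings G m m' \<Longrightarrow> w \<le> transport_cost \<pi>"
  shows "w \<le> wasserstein G m m'"
  unfolding wasserstein_def transport_cost_def[symmetric]
  using assms by (intro cINF_greatest)

text \<open>Mixing a coupling at idleness \<open>p\<close> with the point mass at \<open>(x, y)\<close>, the coupling at idleness
  \<open>1\<close>, gives a coupling at any idleness between \<open>p\<close> and \<open>1\<close>.\<close>

lemma lazy_curvature_quotient_mono:
  assumes xy: "(x, y) \<in> parcs G" and pq: "0 \<le> p" "p \<le> q" "q < 1"
  shows "lazy_curvature G p x y / (1 - p) \<le> lazy_curvature G q x y / (1 - q)"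
proof -
  have V: "x \<in> pverts G" "y \<in> pverts G" using xy in_arcsD1 in_arcsD2 by auto
  define t where "t = (1 - q) / (1 - p)"
  have t: "0 < t" "t \<le> 1" "t * (1 - p) = 1 - q" using pq by (auto simp: t_def)
  then have q: "q = t * p + (1 - t)" by (simp add: algebra_simps)
  let ?C = "\<lambda>p. couplings G (lazy_measure G p x) (lazy_measure G p y)"
  let ?W = "\<lambda>p. wasserstein G (lazy_measure G p x) (lazy_measure G p y)"
  have mix: "lazy_measure G q z u = t * lazy_measure G p z u + (1 - t) * of_bool (u = z)" for z u
    using t(3) by (auto simp: lazy_measure_def q)
  \<comment> \<open>Solved for \<open>?W p\<close>, the infimum to be bounded from below, by mixing
    each coupling at \<open>p\<close> into one at \<open>q\<close>.\<close>
  have "(?W q - (1 - t)) / t \<le> ?W p"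
  proof (rule wasserstein_ge)
    show "?C p \<noteq> {}" using product_coupling[OF V] pq degree_pos[OF xy] by fastforce
    fix \<pi> assume \<pi>: "\<pi> \<in> ?C p"
    define \<rho> where "\<rho> u v = t * \<pi> u v + (1 - t) * (of_bool (u = x) * of_bool (v = y))" for u v
    have delta: "(\<Sum>u\<in>pverts G. g u * of_bool (u = z)) = g z" if "z \<in> pverts G" for g :: "'v \<Rightarrow> real" and z
      using that pair_finite_verts by (simp add: of_bool_def if_distrib cong: if_cong)
    have delta1: "(\<Sum>u\<in>pverts G. of_bool (u = z)) = (1::real)" if "z \<in> pverts G" for z
      using delta[OF that, of "\<lambda>_. 1"] by simp
    have "\<rho> \<in> ?C q"
      unfolding couplings_def
    proof (intro CollectI conjI ballI)
      fix u v assume "u \<in> pverts G" "v \<in> pverts G"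
      then show "0 \<le> \<rho> u v"
        using \<pi> t by (auto simp: \<rho>_def couplings_def intro!: add_nonneg_nonneg)
    next
      fix u assume "u \<in> pverts G"
      then show "(\<Sum>v\<in>pverts G. \<rho> u v) = lazy_measure G q x u"
        using \<pi> by (simp add: \<rho>_def mix sum.distrib sum_distrib_left[symmetric] delta1 V couplings_def)
    next
      fix v assume "v \<in> pverts G"
      then show "(\<Sum>u\<in>pverts G. \<rho> u v) = lazy_measure G q y v"
        using \<pi> by (simp add: \<rho>_def mix sum.distrib sum_distrib_left[symmetric]
            sum_distrib_right[symmetric] delta1 V couplings_def)
    qed
    then have "?W q \<le> transport_cost \<rho>" by (rule wasserstein_le)
    also have "\<dots> = t * transport_cost \<pi> + (1 - t) * (\<Sum>u\<in>pverts G. (\<Sum>v\<in>pverts G.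
        graph_dist G u v * of_bool (v = y)) * of_bool (u = x))"
      by (simp add: transport_cost_def \<rho>_def distrib_left sum.distrib sum_distrib_left
          sum_distrib_right mult_ac del: of_bool_conj sum_of_bool_mult_eq sum_mult_of_bool_eq)
    also have "(\<Sum>u\<in>pverts G. (\<Sum>v\<in>pverts G. graph_dist G u v * of_bool (v = y)) * of_bool (u = x)) = 1"
      using V by (simp add: delta graph_dist_adjacent[OF xy])
    finally show "(?W q - (1 - t)) / t \<le> transport_cost \<pi>"
      using t by (simp add: field_simps)
  qed
  then have "?W q \<le> t * ?W p + (1 - t)"
    using t by (simp add: field_simps)
  then have "t * (1 - ?W p) \<le> 1 - ?W q" by (simp add: algebra_simps)
  then show ?thesis
    using pq by (simp add: lazy_curvature_def graph_dist_adjacent[OF xy] t_def field_simps)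
qed

text \<open>As \<open>f x - f y = 1\<close>, the point masses contribute exactly \<open>p\<close> to
  the dual value, so dividing by \<open>1 - p\<close> leaves a bound independent of
  \<open>p\<close>, which survives the limit.\<close>

lemma lazy_curvature_quotient_le:
  assumes xy: "(x, y) \<in> parcs G" and p: "0 \<le> p" "p < 1" and f: "lipschitz1 f" "f x - f y = 1"
  shows "lazy_curvature G p x y / (1 - p) \<le> 1 - ((\<Sum>u\<in>N x. f u) - (\<Sum>u\<in>N y. f u)) / d"
proof -
  have V: "x \<in> pverts G" "y \<in> pverts G" using xy in_arcsD1 in_arcsD2 by auto
  define S where "S = (\<Sum>u\<in>N x. f u) - (\<Sum>u\<in>N y. f u)"
  have "p + (1 - p) / d * S \<le> wasserstein G (lazy_measure G p x) (lazy_measure G p y)"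
  proof (rule wasserstein_ge)
    show "couplings G (lazy_measure G p x) (lazy_measure G p y) \<noteq> {}"
      using product_coupling[OF V] p degree_pos[OF xy] by fastforce
    fix \<pi> assume "\<pi> \<in> couplings G (lazy_measure G p x) (lazy_measure G p y)"
    note transport_cost_ge[OF f(1) this]
    then have "p * (f x - f y) + (1 - p) / d * S \<le> transport_cost \<pi>"
      unfolding sum_lazy_measure[OF V(1)] sum_lazy_measure[OF V(2)] S_def right_diff_distrib by simp
    then show "p + (1 - p) / d * S \<le> transport_cost \<pi>" using f(2) by simp
  qed
  then have "lazy_curvature G p x y \<le> (1 - p) * (1 - S / d)"
    unfolding lazy_curvature_def graph_dist_adjacent[OF xy] right_diff_distrib by simp
  then show ?thesis using p by (simp add: S_def[symmetric] divide_le_eq mult.commute)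
qed

text \<open>\<open>Lim\<close> is informative only if the limit exists. The quotients are monotone
  in \<open>p\<close> and bounded by the dual estimate, so they converge to their supremum.\<close>

lemma lly_curvature_le:
  assumes xy: "(x, y) \<in> parcs G" and f: "lipschitz1 f" "f x - f y = 1"
  shows "lly_curvature G x y \<le> 1 - ((\<Sum>u\<in>N x. f u) - (\<Sum>u\<in>N y. f u)) / d" (is "_ \<le> ?K")
proof -
  let ?k = "\<lambda>p. lazy_curvature G p x y / (1 - p)"
  have "(?k \<longlongrightarrow> Sup (?k ` ({..<1} \<inter> {0<..}))) (at 1 within ({..<1} \<inter> {0<..}))"
    by (rule Lim_left_bound[where K = ?K])
      (auto intro!: lazy_curvature_quotient_mono[OF xy] lazy_curvature_quotient_le[OF xy _ _ f])
  moreover have "at 1 within ({..<1} \<inter> {0<..}) = at_left (1::real)"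
    by (rule at_within_nhd[of _ "{0<..}"]) auto
  ultimately have "(?k \<longlongrightarrow> Sup (?k ` ({..<1} \<inter> {0<..}))) (at_left 1)" by simp
  then have "lly_curvature G x y = Sup (?k ` ({..<1} \<inter> {0<..}))"
    unfolding lly_curvature_def by (intro tendsto_Lim) auto
  also have "\<dots> \<le> ?K"
  proof (rule cSup_least)
    have "(1 / 2 :: real) \<in> {..<1} \<inter> {0<..}" by simp
    then show "?k ` ({..<1} \<inter> {0<..}) \<noteq> {}" by blast
  qed (auto intro!: lazy_curvature_quotient_le[OF xy _ _ f])
  finally show ?thesis .
qed

section \<open>Spectrum of the normalized Laplacian\<close>

lemma normalized_laplacian_apply:
  assumes x: "x \<in> pverts G"
  shows "(\<Sum>y\<in>pverts G. normalized_laplacian G x y * f y) = f x - (\<Sum>y\<in>N x. f y) / d"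
proof -
  \<comment> \<open>For \<open>d = 0\<close> both sides are 0, by the conventions for
    \<open>powr\<close> and division.\<close>
  have "real d powr (- 1 / 2) * real d powr (- 1 / 2) = 1 / d"
    by (cases "d = 0") (simp_all add: powr_add[symmetric] powr_minus_divide)
  then have "(\<Sum>y\<in>pverts G. normalized_laplacian G x y * f y)
      = (\<Sum>y\<in>pverts G. (if y = x then f y else 0) - (if y \<in> N x then f y / d else 0))"
    using x regular by (intro sum.cong) (auto simp: normalized_laplacian_def mult.assoc algebra_simps)
  also have "\<dots> = f x - (\<Sum>y\<in>pverts G \<inter> N x. f y / d)"
    using x pair_finite_verts by (simp add: sum_subtractf sum.inter_restrict)
  also have "pverts G \<inter> N x = N x" using N_subset by auto
  finally show ?thesis by (simp add: sum_divide_distrib)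
qed

text \<open>\<open>Min\<close> needs a finite nonempty set. The diagonal entries are 1 as there are
  no loops, so some eigenvalue is at least 1, hence nonzero.\<close>

lemma lambda1_eigenvalue:
  shows "laplacian_eigenvalue G (lambda1 G)" "lambda1 G \<noteq> 0"
proof -
  let ?L = "normalized_laplacian G"
  let ?E = "{c. laplacian_eigenvalue G c \<and> c \<noteq> 0}"
  have sym: "?L x y = ?L y x" if "x \<in> pverts G" "y \<in> pverts G" for x y
    using arc_sym by (auto simp: normalized_laplacian_def)
  have "finite ?E"
    by (rule finite_subset[OF _ symmetric_matrix_eigenvalues_finite[OF pair_finite_verts, of ?L]])
      (auto simp: laplacian_eigenvalue_def intro: sym)
  moreover have "?E \<noteq> {}"
  proof -
    obtain z where z: "z \<in> pverts G"
      using connected by (auto simp: Digraph_Component.connected_def strongly_connected_def)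
    have "?L z z = 1" using no_loops' by (auto simp: normalized_laplacian_def)
    moreover obtain f c where "\<exists>x\<in>pverts G. f x \<noteq> 0"
      "\<forall>x\<in>pverts G. (\<Sum>y\<in>pverts G. ?L x y * f y) = c * f x" "?L z z \<le> c"
      by (rule symmetric_matrix_eigenvalue_ge_diagonal[OF pair_finite_verts sym z])
    ultimately have "laplacian_eigenvalue G c" "c \<noteq> 0"
      by (auto simp: laplacian_eigenvalue_def)
    then show ?thesis by blast
  qed
  ultimately have "lambda1 G \<in> ?E"
    unfolding lambda1_def by (rule Min_in)
  then show "laplacian_eigenvalue G (lambda1 G)" "lambda1 G \<noteq> 0" by auto
qed

text \<open>Maximum principle: at a vertex \<open>x\<close> where \<open>f\<close> is largest in
  absolute value, the mean over the neighbours is \<open>(1 - c) * f x\<close> and cannot exceed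
  \<open>f x\<close> in absolute value.\<close>

lemma laplacian_eigenvalue_nonneg:
  assumes "laplacian_eigenvalue G c" and d: "0 < d"
  shows "0 \<le> c"
proof -
  obtain f z where z: "z \<in> pverts G" "f z \<noteq> 0"
    and f: "\<And>x. x \<in> pverts G \<Longrightarrow> f x - (\<Sum>y\<in>N x. f y) / d = c * f x"
    using assms(1) normalized_laplacian_apply by (auto simp: laplacian_eigenvalue_def)
  define m where "m = Max ((\<lambda>x. \<bar>f x\<bar>) ` pverts G)"
  have "m \<in> (\<lambda>x. \<bar>f x\<bar>) ` pverts G"
    unfolding m_def using z(1) pair_finite_verts by (intro Max_in) auto
  then obtain x where x: "x \<in> pverts G" and m: "m = \<bar>f x\<bar>" by blast
  have max: "\<bar>f y\<bar> \<le> \<bar>f x\<bar>" if "y \<in> pverts G" for y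
    unfolding m[symmetric] m_def using that pair_finite_verts by (intro Max_ge) auto
  have pos: "\<bar>f x\<bar> > 0" using max[OF z(1)] z(2) by linarith
  have "\<bar>\<Sum>y\<in>N x. f y\<bar> \<le> (\<Sum>y\<in>N x. \<bar>f x\<bar>)"
    using max N_subset by (intro order_trans[OF sum_abs] sum_mono) auto
  then have "\<bar>\<Sum>y\<in>N x. f y\<bar> \<le> d * \<bar>f x\<bar>" using card_N[OF x] by simp
  then have "\<bar>(\<Sum>y\<in>N x. f y) / d\<bar> \<le> \<bar>f x\<bar>" using d by (simp add: abs_divide field_simps)
  moreover have "(\<Sum>y\<in>N x. f y) / d = (1 - c) * f x" using f[OF x] by (simp add: algebra_simps)
  ultimately have "\<bar>1 - c\<bar> * \<bar>f x\<bar> \<le> 1 * \<bar>f x\<bar>" by (simp add: abs_mult)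
  then have "\<bar>1 - c\<bar> \<le> 1" using pos by (simp only: mult_le_cancel_right)
  then show ?thesis by simp
qed

section \<open>Private neighbours of an edge\<close>

definition private_nbrs :: "'v \<Rightarrow> 'v \<Rightarrow> 'v set" where
  "private_nbrs x y = N x - insert y (N y)"

lemma finite_private_nbrs [simp]: "finite (private_nbrs x y)"
  by (simp add: private_nbrs_def)

text \<open>The target type is general so that the constant 1 in the naturals also yields
  cardinalities.\<close>

lemma sum_N:
  fixes f :: "'v \<Rightarrow> 'b :: comm_monoid_add"
  assumes "(x, y) \<in> parcs G"
  shows "(\<Sum>u\<in>N x. f u) = f y + (\<Sum>u\<in>N x \<inter> N y. f u) + (\<Sum>u\<in>private_nbrs x y. f u)"
proof -
  have "N x = insert y (N x \<inter> N y) \<union> private_nbrs x y"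
    using assms by (auto simp: private_nbrs_def)
  moreover have "(\<Sum>u\<in>insert y (N x \<inter> N y) \<union> private_nbrs x y. f u)
      = (\<Sum>u\<in>insert y (N x \<inter> N y). f u) + (\<Sum>u\<in>private_nbrs x y. f u)"
    by (rule sum.union_disjoint) (auto simp: private_nbrs_def)
  moreover have "y \<notin> N x \<inter> N y" using no_loops' by auto
  ultimately show ?thesis by simp
qed

text \<open>The common neighbours contribute equally to both sums and cancel.\<close>

lemma sum_N_diff:
  fixes f :: "'v \<Rightarrow> real"
  assumes "(x, y) \<in> parcs G"
  shows "(\<Sum>u\<in>N x. f u) - (\<Sum>u\<in>N y. f u)
    = (\<Sum>u\<in>private_nbrs x y. f u) - (\<Sum>u\<in>private_nbrs y x. f u) - (f x - f y)"
  using sum_N[OF assms, of f] sum_N[OF arc_sym[OF assms], of f] by (simp add: Int_commute)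

end

section \<open>Amply regular graphs with \<open>\<beta> = 1\<close>\<close>

locale amply_regular_graph_1 = connected_regular_graph G d
  for G :: "'v pair_pre_digraph" and d +
  fixes \<alpha> :: nat
  assumes not_complete: "parcs G \<noteq> {(u, v). u \<in> pverts G \<and> v \<in> pverts G \<and> u \<noteq> v}"
    and card_common_adjacent: "(x, y) \<in> parcs G \<Longrightarrow> card (N x \<inter> N y) = \<alpha>"
    and card_common_dist_2:
      "x \<in> pverts G \<Longrightarrow> y \<in> pverts G \<Longrightarrow> graph_dist G x y = 2 \<Longrightarrow> card (N x \<inter> N y) = 1"
begin

section \<open>Absence of quadrangles and its local consequences\<close>

text \<open>The form in which \<beta> = 1 is used: a common neighbour puts distinct nonadjacent
  vertices at distance 2, so there is no second one.\<close>

lemma common_neighbour_unique: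
  assumes "(x, u) \<in> parcs G" "(u, y) \<in> parcs G" "(x, v) \<in> parcs G" "(v, y) \<in> parcs G"
    and "x \<noteq> y" "(x, y) \<notin> parcs G"
  shows "u = v"
proof -
  have "card (N x \<inter> N y) = 1"
    using assms graph_dist_eq_2[of x u y] in_arcsD1 in_arcsD2 by (intro card_common_dist_2) auto
  moreover have "u \<in> N x \<inter> N y" "v \<in> N x \<inter> N y" using assms arc_sym by auto
  ultimately show ?thesis by (metis card_1_singletonE singletonD)
qed

text \<open>Each piece has \<alpha> + 1 vertices, and the pieces are disjoint because the
  nonadjacent \<open>y\<close> and \<open>z\<close> have only \<open>x\<close> as common
  neighbour.\<close>

lemma two_cliques:
  assumes xy: "(x, y) \<in> parcs G" and xz: "(x, z) \<in> parcs G" and yz: "y \<noteq> z" "(y, z) \<notin> parcs G"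
  shows "card (insert y (N x \<inter> N y) \<union> insert z (N x \<inter> N z)) = 2 * \<alpha> + 2"
proof -
  have card: "card (insert v (N x \<inter> N v)) = \<alpha> + 1" if "(x, v) \<in> parcs G" for v
    using card_common_adjacent[OF that] no_loops' by (subst card_insert_disjoint) auto
  have "w = x" if "w \<in> N y" "w \<in> N z" for w
    using that xy xz yz arc_sym by (intro common_neighbour_unique[of y w z x]) auto
  then have "insert y (N x \<inter> N y) \<inter> insert z (N x \<inter> N z) = {}"
    using yz no_loops' arc_sym by auto
  then show ?thesis
    using card[OF xy] card[OF xz] by (subst card_Un_disjoint) auto
qed

text \<open>Otherwise distinct neighbours of a vertex are always adjacent, adjacency propagates
  along walks, and the connected graph is complete.\<close>

lemma ex_nonadjacent_neighbours:
  "\<exists>x y z. (x, y) \<in> parcs G \<and> (x, z) \<in> parcs G \<and> y \<noteq> z \<and> (y, z) \<notin> parcs G"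
proof (rule ccontr)
  assume "\<not> ?thesis"
  then have trans: "(y, z) \<in> parcs G" if "(x, y) \<in> parcs G" "(x, z) \<in> parcs G" "y \<noteq> z" for x y z
    using that by blast
  have "u = v \<or> (u, v) \<in> parcs G" if "awalk u p v" for u v p
    using that
  proof (induction p arbitrary: u)
    case (Cons e p)
    then have "(u, snd e) \<in> parcs G" "snd e = v \<or> (snd e, v) \<in> parcs G"
      by (auto simp: awalk_simps)
    then show ?case using trans[of "snd e" u v] arc_sym by auto
  qed (auto simp: awalk_simps)
  then have "(u, v) \<in> parcs G" if "u \<in> pverts G" "v \<in> pverts G" "u \<noteq> v" for u v
    using ex_awalk[of u v] that by blast
  then have "parcs G = {(u, v). u \<in> pverts G \<and> v \<in> pverts G \<and> u \<noteq> v}"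
    by (auto dest: in_arcsD1 in_arcsD2 no_loops')
  then show False using not_complete by simp
qed

text \<open>Both pieces of \<open>two_cliques\<close> fit inside one neighbourhood.\<close>

lemma degree_ge: "2 * \<alpha> + 2 \<le> d"
proof -
  obtain x y z where xyz: "(x, y) \<in> parcs G" "(x, z) \<in> parcs G" "y \<noteq> z" "(y, z) \<notin> parcs G"
    using ex_nonadjacent_neighbours by blast
  then have "insert y (N x \<inter> N y) \<union> insert z (N x \<inter> N z) \<subseteq> N x" by auto
  from card_mono[OF finite_N this] show ?thesis
    using two_cliques[OF xyz] card_N[of x] in_arcsD1[OF xyz(1)] by simp
qed

lemma card_private_nbrs:
  assumes "(x, y) \<in> parcs G"
  shows "card (private_nbrs x y) = d - 1 - \<alpha>"
  using sum_N[OF assms, of "\<lambda>_. 1::nat"] card_N[OF in_arcsD1[OF assms]] card_common_adjacent[OF assms]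
  by simp

text \<open>An arc from \<open>a\<close> to \<open>b\<close> would close the quadrangle
  \<open>x a b y\<close>, in which \<open>a\<close> and \<open>y\<close> are not adjacent.\<close>

lemma private_nbrs_not_adjacent:
  assumes xy: "(x, y) \<in> parcs G" and a: "a \<in> private_nbrs x y" and b: "b \<in> private_nbrs y x"
  shows "(a, b) \<notin> parcs G"
proof
  assume "(a, b) \<in> parcs G"
  then have "x = b"
    using xy a b arc_sym
    by (intro common_neighbour_unique[of a x y b]) (auto simp: private_nbrs_def)
  then show False using b by (simp add: private_nbrs_def)
qed

section \<open>Upper bounds on the curvature of an edge\<close>

text \<open>\<open>lly_curvature_le\<close> is applied to a potential with \<open>h x = 2\<close>,
  \<open>h y = 1\<close> and value 0 on \<open>private_nbrs y x\<close>. The lower bound 2 comes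
  from \<open>private_nbrs_not_adjacent\<close>; the value 3 penalises a private neighbour without a
  partner at distance 2.\<close>

lemma lly_curvature_le_potential:
  assumes xy: "(x, y) \<in> parcs G"
  obtains h :: "'v \<Rightarrow> real"
  where "lly_curvature G x y \<le> (real d + 1 - (\<Sum>a\<in>private_nbrs x y. h a)) / d"
    and "\<forall>a\<in>private_nbrs x y. 2 \<le> h a"
    and "\<forall>a\<in>private_nbrs x y. (\<forall>b\<in>private_nbrs y x. N a \<inter> N b = {}) \<longrightarrow> h a = 3"
proof -
  let ?B = "private_nbrs y x"
  \<comment> \<open>the distance to \<open>private_nbrs y x\<close>, truncated at \<open>3\<close>\<close>
  define h :: "'v \<Rightarrow> real" where
    "h z = (if z \<in> ?B then 0 else if \<exists>b\<in>?B. (z, b) \<in> parcs G then 1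
      else if \<exists>b\<in>?B. \<exists>w. (z, w) \<in> parcs G \<and> (w, b) \<in> parcs G then 2 else 3)" for z
  have lip: "lipschitz1 h"
    unfolding lipschitz1_def
  proof (intro allI impI)
    fix u v assume "(u, v) \<in> parcs G"
    then show "h u - h v \<le> 1" by (auto simp: h_def)
  qed
  have "card ?B > 0"
    using card_private_nbrs[OF arc_sym[OF xy]] degree_ge by simp
  then obtain b where b: "b \<in> ?B" by fastforce
  have x: "x \<notin> ?B" "\<not> (\<exists>b\<in>?B. (x, b) \<in> parcs G)" and y: "y \<notin> ?B"
    using no_loops' by (auto simp: private_nbrs_def)
  have yb: "(y, b) \<in> parcs G" using b by (simp add: private_nbrs_def)
  have hx: "h x = 2" unfolding h_def using x xy yb b by auto
  have hy: "h y = 1" unfolding h_def using y yb b by auto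
  have a: "a \<notin> ?B" "\<not> (\<exists>b\<in>?B. (a, b) \<in> parcs G)" if "a \<in> private_nbrs x y" for a
    using that private_nbrs_not_adjacent[OF xy that] by (auto simp: private_nbrs_def)
  show thesis
  proof
    have "(\<Sum>u\<in>?B. h u) = 0" by (simp add: h_def)
    then show "lly_curvature G x y \<le> (real d + 1 - (\<Sum>a\<in>private_nbrs x y. h a)) / d"
      using lly_curvature_le[OF xy lip] sum_N_diff[OF xy, of h] degree_pos[OF xy] hx hy
      by (simp add: field_simps)
    show "\<forall>a\<in>private_nbrs x y. 2 \<le> h a"
      using a by (auto simp: h_def)
    show "\<forall>a\<in>private_nbrs x y. (\<forall>b\<in>?B. N a \<inter> N b = {}) \<longrightarrow> h a = 3"
    proof (intro ballI impI)
      fix u assume u: "u \<in> private_nbrs x y" "\<forall>b\<in>?B. N u \<inter> N b = {}"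
      then have "\<not> (\<exists>b\<in>?B. \<exists>w. (u, w) \<in> parcs G \<and> (w, b) \<in> parcs G)"
        using arc_sym by blast
      then show "h u = 3" using a[OF u(1)] by (auto simp: h_def)
    qed
  qed
qed

text \<open>Positivity keeps the sum of \<open>h\<close> below \<open>d + 1\<close>, while it is at
  least 2 on each of \<open>d - 1 - \<alpha>\<close> vertices; this meets \<open>degree_ge\<close>
  and fixes \<open>d\<close>. The sum is then at least \<open>d\<close>, and a single vertex with
  \<open>h a = 3\<close> would raise it to \<open>d + 1\<close>.\<close>

lemma positive_curvature:
  assumes xy: "(x, y) \<in> parcs G" and pos: "0 < lly_curvature G x y"
  shows "d = 2 * \<alpha> + 2" and "lly_curvature G x y \<le> 1 / d"
    and "\<And>a. a \<in> private_nbrs x y \<Longrightarrow> \<exists>b\<in>private_nbrs y x. N a \<inter> N b \<noteq> {}"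
proof -
  obtain h :: "'v \<Rightarrow> real" where h: "lly_curvature G x y \<le> (real d + 1 - (\<Sum>a\<in>private_nbrs x y. h a)) / d"
    "\<forall>a\<in>private_nbrs x y. 2 \<le> h a"
    "\<forall>a\<in>private_nbrs x y. (\<forall>b\<in>private_nbrs y x. N a \<inter> N b = {}) \<longrightarrow> h a = 3"
    by (rule lly_curvature_le_potential[OF xy])
  let ?A = "private_nbrs x y"
  have d: "0 < d" by (rule degree_pos[OF xy])
  have card: "real (card ?A) = real d - 1 - \<alpha>"
    using card_private_nbrs[OF xy] degree_ge by simp
  have "0 < (real d + 1 - (\<Sum>a\<in>?A. h a)) / d" using pos h(1) by linarith
  then have less: "(\<Sum>a\<in>?A. h a) < d + 1" using d by (simp add: zero_less_divide_iff)
  have ge: "2 * real (card ?A) \<le> (\<Sum>a\<in>?A. h a)"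
    using sum_mono[of ?A "\<lambda>_. 2" h] h(2) by simp
  have "real d < 2 * \<alpha> + 3" using less ge card by linarith
  then have "d < 2 * \<alpha> + 3" by linarith
  then show deg: "d = 2 * \<alpha> + 2" using degree_ge by simp
  then have "real d + 1 - (\<Sum>a\<in>?A. h a) \<le> 1" using ge card by simp
  then have "(real d + 1 - (\<Sum>a\<in>?A. h a)) / d \<le> 1 / d" by (intro divide_right_mono) auto
  then show "lly_curvature G x y \<le> 1 / d" using h(1) by linarith
  fix a assume a: "a \<in> ?A"
  show "\<exists>b\<in>private_nbrs y x. N a \<inter> N b \<noteq> {}"
  proof (rule ccontr)
    assume "\<not> ?thesis"
    then have "h a = 3" using h(3) a by blast
    moreover have "2 * real (card (?A - {a})) \<le> (\<Sum>a\<in>?A - {a}. h a)"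
      using sum_mono[of "?A - {a}" "\<lambda>_. 2" h] h(2) by simp
    moreover have "real (card ?A) = real (card (?A - {a})) + 1"
      using card_Suc_Diff1[OF finite_private_nbrs a] by simp
    ultimately have "2 * real (card ?A) + 1 \<le> (\<Sum>a\<in>?A. h a)"
      using sum.remove[OF finite_private_nbrs a, of h] by simp
    then show False using less card deg by simp
  qed
qed

section \<open>Induced pentagons and the matching of private neighbours\<close>

text \<open>Each excluded coincidence or chord contradicts the choice of \<open>a\<close> or
  \<open>b\<close>, or gives a second common neighbour to the nonadjacent pair \<open>x\<close>,
  \<open>b\<close> or \<open>a\<close>, \<open>y\<close>.\<close>

lemma pentagon_induced:
  assumes xy: "(x, y) \<in> parcs G" and a: "a \<in> private_nbrs x y" and b: "b \<in> private_nbrs y x"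
    and e: "(a, e) \<in> parcs G" "(e, b) \<in> parcs G"
  shows "e \<noteq> x" "e \<noteq> y" "(x, e) \<notin> parcs G" "(y, e) \<notin> parcs G" "a \<noteq> b"
proof -
  show ne: "e \<noteq> x" "e \<noteq> y"
    using a b e arc_sym by (auto simp: private_nbrs_def)
  show "(x, e) \<notin> parcs G"
    using common_neighbour_unique[of x e b y] xy b e ne by (auto simp: private_nbrs_def)
  show "(y, e) \<notin> parcs G"
    using common_neighbour_unique[of a e y x] xy a e ne arc_sym by (auto simp: private_nbrs_def)
  show "a \<noteq> b" using a b by (auto simp: private_nbrs_def)
qed

text \<open>If \<open>a\<close> and \<open>a'\<close> differ, they are adjacent inside
  \<open>N x\<close>, and \<open>e\<close>, \<open>e'\<close> are equal or adjacent inside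
  \<open>N b\<close>. As \<open>a\<close> and \<open>e'\<close> are not adjacent, \<open>e\<close>
  and \<open>a'\<close> are both their common neighbour, so \<open>e = a'\<close>, although
  \<open>e\<close> is not adjacent to \<open>x\<close>.\<close>

lemma private_nbrs_matching:
  assumes deg: "d = 2 * \<alpha> + 2" and xy: "(x, y) \<in> parcs G"
    and a: "a \<in> private_nbrs x y" and a': "a' \<in> private_nbrs x y" and b: "b \<in> private_nbrs y x"
    and e: "(a, e) \<in> parcs G" "(e, b) \<in> parcs G" and e': "(a', e') \<in> parcs G" "(e', b) \<in> parcs G"
  shows "a = a'"
proof (rule ccontr)
  assume neq: "a \<noteq> a'"
  \<comment> \<open>As \<open>d = 2\<alpha> + 2\<close>, each neighbourhood is a union of two cliques.\<close>
  have clique: "u = v \<or> (u, v) \<in> parcs G"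
    if "(w, z) \<in> parcs G" "(w, u) \<in> parcs G" "(w, v) \<in> parcs G" "u \<noteq> z" "v \<noteq> z"
      "(u, z) \<notin> parcs G" "(v, z) \<notin> parcs G" for u v w z
  proof -
    have "insert z (N w \<inter> N z) \<union> insert u (N w \<inter> N u) = N w"
    proof (rule card_subset_eq)
      show "card (insert z (N w \<inter> N z) \<union> insert u (N w \<inter> N u)) = card (N w)"
        using two_cliques[of w z u] that arc_sym card_N[OF in_arcsD1[OF that(1)]] deg by auto
    qed (use that in auto)
    then show ?thesis using that arc_sym by blast
  qed
  note pent = pentagon_induced[OF xy a b e] pentagon_induced[OF xy a' b e']
  have aa': "(a, a') \<in> parcs G"
    using clique[of x y a a'] xy a a' neq arc_sym by (auto simp: private_nbrs_def)
  have ee': "e = e' \<or> (e, e') \<in> parcs G"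
    using clique[of b y e e'] b e e' pent arc_sym by (auto simp: private_nbrs_def)
  have "(a, e') \<notin> parcs G"
    using common_neighbour_unique[of x a e' a'] pent a a' e' neq by (auto simp: private_nbrs_def)
  then show False
    using common_neighbour_unique[of a e e' a'] ee' aa' e e' pent arc_sym
      common_neighbour_unique[of x a e a'] by (metis a a' neq private_nbrs_def DiffD1 mem_Collect_eq)
qed

section \<open>Edges of maximal drop of an eigenfunction\<close>

text \<open>Subtracting the eigenvalue equations at \<open>x\<close> and \<open>y\<close>, the drops
  over matched pairs sum to \<open>(d + 1 - d * c) * M\<close>, at least \<open>d * M\<close>. There
  are only \<open>d / 2\<close> pairs, each dropping at most \<open>2 * M\<close> along a path of
  length 2, so equality holds for every pair.\<close>

lemma extremal_edge:
  fixes f :: "'v \<Rightarrow> real"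
  assumes deg: "d = 2 * \<alpha> + 2"
    and matched: "\<And>a. a \<in> private_nbrs x y \<Longrightarrow> \<exists>b\<in>private_nbrs y x. N a \<inter> N b \<noteq> {}"
    and eig: "\<And>x. x \<in> pverts G \<Longrightarrow> f x - (\<Sum>y\<in>N x. f y) / d = c * f x" and c: "c \<le> 1 / d"
    and M: "\<And>u v. (u, v) \<in> parcs G \<Longrightarrow> f u - f v \<le> M"
    and xy: "(x, y) \<in> parcs G" "f x - f y = M" "0 \<le> M"
    and a: "a \<in> private_nbrs x y" and b: "b \<in> private_nbrs y x"
    and e: "(a, e) \<in> parcs G" "(e, b) \<in> parcs G"
  shows "f a - f e = M" "f e - f b = M"
proof -
  let ?A = "private_nbrs x y" and ?B = "private_nbrs y x"
  \<comment> \<open>An arbitrary choice of partners is overridden at \<open>a\<close>, so that the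
    given \<open>a\<close> and \<open>b\<close> are matched; injectivity holds for any such
    choice.\<close>
  obtain \<phi> where "\<And>a. a \<in> ?A \<Longrightarrow> \<phi> a \<in> ?B \<and> N a \<inter> N (\<phi> a) \<noteq> {}"
    using matched by metis
  moreover have "N a \<inter> N b \<noteq> {}" using e arc_sym by auto
  ultimately obtain \<phi> where \<phi>: "\<And>a. a \<in> ?A \<Longrightarrow> \<phi> a \<in> ?B" "\<And>a. a \<in> ?A \<Longrightarrow> N a \<inter> N (\<phi> a) \<noteq> {}"
    and \<phi>a: "\<phi> a = b"
    using b that[of "\<phi>(a := b)"] by auto
  then have ex: "\<exists>e. (a, e) \<in> parcs G \<and> (e, \<phi> a) \<in> parcs G" if "a \<in> ?A" for a
    using that arc_sym by blast
  have inj: "inj_on \<phi> ?A"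
  proof (rule inj_onI)
    fix u v assume uv: "u \<in> ?A" "v \<in> ?A" "\<phi> u = \<phi> v"
    obtain e e' where "(u, e) \<in> parcs G" "(e, \<phi> u) \<in> parcs G" "(v, e') \<in> parcs G" "(e', \<phi> u) \<in> parcs G"
      using ex[OF uv(1)] ex[OF uv(2)] uv(3) by auto
    then show "u = v"
      using private_nbrs_matching[OF deg xy(1) uv(1,2) \<phi>(1)[OF uv(1)]] by blast
  qed
  have "card (\<phi> ` ?A) = card ?B"
    using card_image[OF inj] card_private_nbrs[OF xy(1)] card_private_nbrs[OF arc_sym[OF xy(1)]]
    by simp
  then have "\<phi> ` ?A = ?B"
    using \<phi>(1) by (intro card_subset_eq finite_private_nbrs image_subsetI)
  then have sumB: "(\<Sum>u\<in>?B. f u) = (\<Sum>u\<in>?A. f (\<phi> u))"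
    using sum.reindex[OF inj, of f] by (simp add: comp_def)
  have d: "0 < d" by (rule degree_pos[OF xy(1)])
  have "c * M = M - ((\<Sum>u\<in>N x. f u) - (\<Sum>u\<in>N y. f u)) / d"
    using eig[OF in_arcsD1[OF xy(1)]] eig[OF in_arcsD2[OF xy(1)]] xy(2)
    by (auto simp: algebra_simps diff_divide_distrib)
  then have "d * (c * M) = d * M - ((\<Sum>u\<in>N x. f u) - (\<Sum>u\<in>N y. f u))"
    using d by (simp add: field_simps)
  then have "(\<Sum>u\<in>?A. f u - f (\<phi> u)) = d * M + M - (d * c) * M"
    using sum_N_diff[OF xy(1), of f] sumB xy(2) by (simp add: sum_subtractf)
  moreover have "(d * c) * M \<le> 1 * M"
    using c d xy(3) by (intro mult_right_mono) (auto simp: field_simps)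
  ultimately have ge: "d * M \<le> (\<Sum>u\<in>?A. f u - f (\<phi> u))" by simp
  have le: "f u - f (\<phi> u) \<le> 2 * M" if u: "u \<in> ?A" for u
  proof -
    obtain e where "(u, e) \<in> parcs G" "(e, \<phi> u) \<in> parcs G" using ex[OF u] by blast
    from M[OF this(1)] M[OF this(2)] show ?thesis by simp
  qed
  have "\<not> f a - f (\<phi> a) < 2 * M"
  proof
    assume "f a - f (\<phi> a) < 2 * M"
    then have "(\<Sum>u\<in>?A. f u - f (\<phi> u)) < (\<Sum>u\<in>?A. 2 * M)"
      using a le by (intro sum_strict_mono_ex1) auto
    also have "\<dots> = d * M"
      using card_private_nbrs[OF xy(1)] deg by (simp add: algebra_simps)
    finally show False using ge by simp
  qed
  then have "f a - f b \<ge> 2 * M" using \<phi>a by simp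
  with M[OF e(1)] M[OF e(2)] show "f a - f e = M" "f e - f b = M" by auto
qed

lemma eigenvalue_gt:
  assumes deg: "d = 2 * \<alpha> + 2"
    and matched: "\<And>x y a. (x, y) \<in> parcs G \<Longrightarrow> a \<in> private_nbrs x y
      \<Longrightarrow> \<exists>b\<in>private_nbrs y x. N a \<inter> N b \<noteq> {}"
    and eig: "laplacian_eigenvalue G c" and "c \<noteq> 0"
  shows "1 / d < c"
proof (rule ccontr)
  assume "\<not> 1 / d < c"
  then have c: "c \<le> 1 / d" by simp
  obtain f z where z: "z \<in> pverts G" "f z \<noteq> 0"
    and f: "\<And>x. x \<in> pverts G \<Longrightarrow> f x - (\<Sum>y\<in>N x. f y) / d = c * f x"
    using eig normalized_laplacian_apply by (auto simp: laplacian_eigenvalue_def)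
  have d: "0 < d" using deg by simp
  define S where "S = (\<lambda>(u, v). f u - f v) ` parcs G"
  have "N z \<noteq> {}" using card_N[OF z(1)] d by fastforce
  then have S: "finite S" "S \<noteq> {}" using pair_finite_arcs by (auto simp: S_def)
  define M where "M = Max S"
  have M: "f u - f v \<le> M" if "(u, v) \<in> parcs G" for u v
    unfolding M_def using S that by (intro Max_ge) (auto simp: S_def)
  obtain x y where xy: "(x, y) \<in> parcs G" "f x - f y = M"
    using Max_in[OF S] unfolding M_def[symmetric] by (auto simp: S_def)
  \<comment> \<open>Otherwise \<open>f\<close> is constant on \<open>z\<close> and its neighbours,
    and the equation at \<open>z\<close> gives \<open>c * f z = 0\<close>.\<close>
  have "M > 0"
  proof (rule ccontr)
    assume "\<not> M > 0"
    then have "f u = f v" if "(u, v) \<in> parcs G" for u v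
      using M[OF that] M[OF arc_sym[OF that]] by simp
    then have "f u = f z" if "u \<in> N z" for u
      using that by auto
    then have "(\<Sum>u\<in>N z. f u) = d * f z"
      using card_N[OF z(1)] by simp
    then have "c * f z = 0"
      using f[OF z(1)] d by simp
    then show False using z(2) \<open>c \<noteq> 0\<close> by simp
  qed
  have ext: "f a - f e = M" "f e - f b = M"
    if "(x, y) \<in> parcs G" "f x - f y = M" "a \<in> private_nbrs x y" "b \<in> private_nbrs y x"
      "(a, e) \<in> parcs G" "(e, b) \<in> parcs G" for x y a b e
    using extremal_edge[OF deg matched f c M that(1,2) less_imp_le[OF \<open>M > 0\<close>] that(3-)] that(1)
    by auto
  have "card (private_nbrs x y) > 0"
    using card_private_nbrs[OF xy(1)] deg by simp
  then obtain a where a: "a \<in> private_nbrs x y" by fastforce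
  then obtain b e where b: "b \<in> private_nbrs y x" and e: "(a, e) \<in> parcs G" "(e, b) \<in> parcs G"
    using matched[OF xy(1)] arc_sym by blast
  note pent = pentagon_induced[OF xy(1) a b e] private_nbrs_not_adjacent[OF xy(1) a b]
  have arcs: "(x, a) \<in> parcs G" "(y, b) \<in> parcs G" "(a, y) \<notin> parcs G" "(b, x) \<notin> parcs G" "a \<noteq> y" "b \<noteq> x"
    using a b arc_sym by (auto simp: private_nbrs_def)
  \<comment> \<open>Extremality propagates around the pentagon \<open>x a e b y\<close>, which the orientation cannot support.\<close>
  have 1: "f a - f e = M" "f e - f b = M"
    using ext[OF xy a b e] by auto
  \<comment> \<open>The edge \<open>e b\<close> also drops by \<open>M\<close>; its private
    neighbours \<open>a\<close> and \<open>y\<close> are joined through \<open>x\<close>.\<close>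
  have 2: "f a - f x = M"
    using ext(1)[of e b a y x] 1 e arcs pent xy(1) arc_sym by (auto simp: private_nbrs_def)
  have 3: "f x - f y = M" "f y - f b = M"
    using ext[of a e x b y] 1 e arcs pent xy(1) arc_sym by (auto simp: private_nbrs_def)
  \<comment> \<open>From \<open>a\<close> to \<open>b\<close> the drop is \<open>2 * M\<close>
    through \<open>e\<close> but \<open>3 * M\<close> through \<open>x\<close> and
    \<open>y\<close>.\<close>
  show False using 1 2 3 \<open>M > 0\<close> by simp
qed

text \<open>Sharpness makes every edge positively curved, hence of curvature at most
  \<open>1 / d\<close>, while \<open>eigenvalue_gt\<close> then puts \<open>lambda1 G\<close>
  strictly above \<open>1 / d\<close>.\<close>

lemma not_lichnerowicz_sharp: "\<not> lichnerowicz_sharp G"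
proof
  assume "lichnerowicz_sharp G"
  then have sharp: "lambda1 G = Min ((\<lambda>(x, y). lly_curvature G x y) ` parcs G)"
    by (simp add: lichnerowicz_sharp_def)
  obtain x y where xy: "(x, y) \<in> parcs G"
    using ex_nonadjacent_neighbours by blast
  have le: "lambda1 G \<le> lly_curvature G u v" if "(u, v) \<in> parcs G" for u v
    unfolding sharp using that pair_finite_arcs by (intro Min_le) auto
  have "0 < lambda1 G"
    using laplacian_eigenvalue_nonneg[OF lambda1_eigenvalue(1) degree_pos[OF xy]] lambda1_eigenvalue(2)
    by simp
  then have pos: "0 < lly_curvature G u v" if "(u, v) \<in> parcs G" for u v
    using le[OF that] by simp
  have "1 / d < lambda1 G"
    using positive_curvature[OF _ pos] xy lambda1_eigenvalue by (intro eigenvalue_gt) blast+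
  then show False
    using positive_curvature(2)[OF xy pos[OF xy]] le[OF xy] by simp
qed

end

theorem theorem4p3:
  fixes G :: "'v pair_pre_digraph" and n d \<alpha> :: nat
  assumes "amply_regular G n d \<alpha> 1"
  shows "\<not> lichnerowicz_sharp G"
proof -
  interpret pair_graph G using assms by (simp add: amply_regular_def)
  interpret amply_regular_graph_1 G d \<alpha>
  proof unfold_locales
    have N: "{z. (x, z) \<in> parcs G} \<inter> {z. (y, z) \<in> parcs G} = common_neighbours G x y" for x y
      by (auto simp: common_neighbours_def)
    show "Digraph_Component.connected (with_proj G)"
      and "\<And>x. x \<in> pverts G \<Longrightarrow> out_degree (with_proj G) x = d"
      and "\<And>x y. (x, y) \<in> parcs G \<Longrightarrow> card ({z. (x, z) \<in> parcs G} \<inter> {z. (y, z) \<in> parcs G}) = \<alpha>"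
      and "\<And>x y. x \<in> pverts G \<Longrightarrow> y \<in> pverts G \<Longrightarrow> graph_dist G x y = 2
        \<Longrightarrow> card ({z. (x, z) \<in> parcs G} \<inter> {z. (y, z) \<in> parcs G}) = 1"
      using assms in_arcsD1 in_arcsD2 unfolding amply_regular_def N by blast+
    show "parcs G \<noteq> {(u, v). u \<in> pverts G \<and> v \<in> pverts G \<and> u \<noteq> v}"
      using assms pair_finite_verts by (auto simp: amply_regular_def complete_digraph_pair_def)
  qed
  show ?thesis by (rule not_lichnerowicz_sharp)
qed

end
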